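(* Let $G$ be an Abelian group and $S$ a subsemigroup of $G$ with $0\in S$. The following conditions are equivalent: (1) the space $G_S$ is compact; (2) the space $G_S$ is $\omega$-bounded; (3) the space $G_S$ is totally countably compact; (4) the paratopological group $G_S$ is precompact; (5) the semigroup $S$ is a subgroup of $G$ of finite index.
   Context: For an Abelian group $G$ (written additively) and a subsemigroup $S\ni 0$ of $G$, $G_S$ denotes the group $G$ endowed with the topology consisting of all sets $A+S$ with $A\subseteq G$; it is a paratopological group (addition is continuous). A space $X$ is $\omega$-bounded if each countable subset of $X$ has compact closure; totally countably compact if each sequence in $X$ contains a subsequence whose set of terms has compact closure. Compactness means every open cover has a finite subcover; no separation axioms are assumed. A paratopological group $G$ (written additively) is precompact if for each neighborhood $U$ of the identity there is a finite $F\subseteq G$ with $F+U=G$. *)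

theory Defs
  imports "HOL-Analysis.Abstract_Topology" "HOL-Analysis.Product_Topology" "HOL-Algebra.Coset"
begin

text \<open>
  Groups are the groups of HOL-Algebra, whose operation is written multiplicatively: \<open>A <#> S\<close>
  stands for the sumset $A + S$ and \<open>\<one>\<close> for the element $0$.  A subsemigroup of \<open>G\<close> containing the
  neutral element is a \<open>submonoid\<close>.
\<close>

definition translate_topology :: "('a, 'b) monoid_scheme \<Rightarrow> 'a set \<Rightarrow> 'a topology"
  where "translate_topology G S = topology (\<lambda>U. \<exists>A \<subseteq> carrier G. U = A <#>\<^bsub>G\<^esub> S)"

definition omega_bounded :: "'a topology \<Rightarrow> bool"
  where "omega_bounded X \<longleftrightarrow>
    (\<forall>C \<subseteq> topspace X. countable C \<longrightarrow> compactin X (X closure_of C))"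

definition totally_countably_compact :: "'a topology \<Rightarrow> bool"
  where "totally_countably_compact X \<longleftrightarrow>
    (\<forall>x :: nat \<Rightarrow> 'a. range x \<subseteq> topspace X \<longrightarrow>
      (\<exists>r :: nat \<Rightarrow> nat. strict_mono r \<and> compactin X (X closure_of (range (x \<circ> r)))))"

locale paratopological_group = group G for G (structure) +
  fixes T :: "'a topology"
  assumes topspace_eq: "topspace T = carrier G"
    and continuous_mult: "continuous_map (prod_topology T T) T (\<lambda>(x, y). x \<otimes> y)"

definition precompact_group :: "('a, 'b) monoid_scheme \<Rightarrow> 'a topology \<Rightarrow> bool"
  where "precompact_group G T \<longleftrightarrow>
    (\<forall>U \<subseteq> carrier G. (\<exists>V. openin T V \<and> \<one>\<^bsub>G\<^esub> \<in> V \<and> V \<subseteq> U) \<longrightarrow>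
      (\<exists>F \<subseteq> carrier G. finite F \<and> F <#>\<^bsub>G\<^esub> U = carrier G))"

text \<open>
  \<open>topology\<close> is only meaningful on predicates that satisfy the axioms of a topology; the next
  lemmas show that this is so here and that the result is a paratopological group.
\<close>

lemma translate_iff:
  assumes "group G" "submonoid S G"
  shows "(\<exists>A \<subseteq> carrier G. U = A <#>\<^bsub>G\<^esub> S) \<longleftrightarrow>
    U \<subseteq> carrier G \<and> (\<forall>u\<in>U. \<forall>s\<in>S. u \<otimes>\<^bsub>G\<^esub> s \<in> U)"
proof -
  interpret group G by fact
  interpret submonoid S G by fact
  show ?thesis
  proof
    assume "\<exists>A \<subseteq> carrier G. U = A <#>\<^bsub>G\<^esub> S"
    then obtain A where A: "A \<subseteq> carrier G" "U = A <#>\<^bsub>G\<^esub> S" by blast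
    have "a \<otimes>\<^bsub>G\<^esub> s \<otimes>\<^bsub>G\<^esub> t \<in> U" if "a \<in> A" "s \<in> S" "t \<in> S" for a s t
    proof -
      have "a \<otimes>\<^bsub>G\<^esub> s \<otimes>\<^bsub>G\<^esub> t = a \<otimes>\<^bsub>G\<^esub> (s \<otimes>\<^bsub>G\<^esub> t)"
        using that A subset by (intro m_assoc) auto
      then show ?thesis using that A(2) unfolding set_mult_def by blast
    qed
    then show "U \<subseteq> carrier G \<and> (\<forall>u\<in>U. \<forall>s\<in>S. u \<otimes>\<^bsub>G\<^esub> s \<in> U)"
      using A subset by (auto simp: set_mult_def)
  next
    assume U: "U \<subseteq> carrier G \<and> (\<forall>u\<in>U. \<forall>s\<in>S. u \<otimes>\<^bsub>G\<^esub> s \<in> U)"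
    have "u \<in> U <#>\<^bsub>G\<^esub> S" if "u \<in> U" for u
    proof -
      have "u \<otimes>\<^bsub>G\<^esub> \<one>\<^bsub>G\<^esub> = u" using that U by (intro r_one) auto
      then show ?thesis using that one_closed unfolding set_mult_def by blast
    qed
    then have "U = U <#>\<^bsub>G\<^esub> S" using U by (auto simp: set_mult_def)
    then show "\<exists>A \<subseteq> carrier G. U = A <#>\<^bsub>G\<^esub> S" using U by blast
  qed
qed

lemma openin_translate_topology:
  assumes "group G" "submonoid S G"
  shows "openin (translate_topology G S) U \<longleftrightarrow> (\<exists>A \<subseteq> carrier G. U = A <#>\<^bsub>G\<^esub> S)"
proof -
  have "istopology (\<lambda>U. \<exists>A \<subseteq> carrier G. U = A <#>\<^bsub>G\<^esub> S)"
    unfolding translate_iff[OF assms] istopology_def by blast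
  then show ?thesis
    by (simp add: translate_topology_def topology_inverse')
qed

lemma topspace_translate_topology:
  assumes "group G" "submonoid S G"
  shows "topspace (translate_topology G S) = carrier G"
proof -
  interpret group G by fact
  interpret submonoid S G by fact
  have "openin (translate_topology G S) (carrier G)"
    unfolding openin_translate_topology[OF assms] translate_iff[OF assms] using subset by auto
  moreover have "openin (translate_topology G S) U \<Longrightarrow> U \<subseteq> carrier G" for U
    unfolding openin_translate_topology[OF assms] translate_iff[OF assms] by blast
  ultimately show ?thesis
    by (meson openin_subset openin_topspace subset_antisym)
qed

lemma paratopological_group_translate_topology:
  assumes "comm_group G" "submonoid S G"
  shows "paratopological_group G (translate_topology G S)"
proof -
  interpret comm_group G by fact
  interpret submonoid S G by fact
  let ?T = "translate_topology G S"
  have G: "group G" by (rule is_group)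
  note op = openin_translate_topology[OF G assms(2)] translate_iff[OF G assms(2)]
  note top = topspace_translate_topology[OF G assms(2)]
  have nb: "openin ?T ({x} <#>\<^bsub>G\<^esub> S)" "x \<in> {x} <#>\<^bsub>G\<^esub> S" if "x \<in> carrier G" for x
  proof -
    show "openin ?T ({x} <#>\<^bsub>G\<^esub> S)" using that unfolding op(1) by blast
    show "x \<in> {x} <#>\<^bsub>G\<^esub> S"
      using r_one[OF that] one_closed unfolding set_mult_def by (metis UN_iff singletonI)
  qed
  show ?thesis
  proof
    show "topspace ?T = carrier G" by (rule top)
    show "continuous_map (prod_topology ?T ?T) ?T (\<lambda>(x, y). x \<otimes>\<^bsub>G\<^esub> y)"
      unfolding continuous_map_def topspace_prod_topology top
    proof (intro conjI allI impI)
      fix U assume U: "openin ?T U"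
      show "openin (prod_topology ?T ?T) {p \<in> carrier G \<times> carrier G. (case p of (x, y) \<Rightarrow> x \<otimes>\<^bsub>G\<^esub> y) \<in> U}"
        unfolding openin_prod_topology_alt
      proof (intro allI impI)
        fix x y
        assume "(x, y) \<in> {p \<in> carrier G \<times> carrier G. (case p of (x, y) \<Rightarrow> x \<otimes>\<^bsub>G\<^esub> y) \<in> U}"
        then have xy: "x \<in> carrier G" "y \<in> carrier G" "x \<otimes>\<^bsub>G\<^esub> y \<in> U" by auto
        have "x \<otimes>\<^bsub>G\<^esub> s \<otimes>\<^bsub>G\<^esub> (y \<otimes>\<^bsub>G\<^esub> t) \<in> U" if "s \<in> S" "t \<in> S" for s t
        proof -
          have "x \<otimes>\<^bsub>G\<^esub> s \<otimes>\<^bsub>G\<^esub> (y \<otimes>\<^bsub>G\<^esub> t) = x \<otimes>\<^bsub>G\<^esub> y \<otimes>\<^bsub>G\<^esub> (s \<otimes>\<^bsub>G\<^esub> t)"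
            using that xy subset by (simp add: m_ac subset_iff)
          then show ?thesis
            using U xy that unfolding op by auto
        qed
        then have "({x} <#>\<^bsub>G\<^esub> S) \<times> ({y} <#>\<^bsub>G\<^esub> S)
            \<subseteq> {p \<in> carrier G \<times> carrier G. (case p of (x, y) \<Rightarrow> x \<otimes>\<^bsub>G\<^esub> y) \<in> U}"
          using xy subset by (auto simp: set_mult_def)
        then show "\<exists>V W. openin ?T V \<and> openin ?T W \<and> x \<in> V \<and> y \<in> W \<and> V \<times> W
            \<subseteq> {p \<in> carrier G \<times> carrier G. (case p of (x, y) \<Rightarrow> x \<otimes>\<^bsub>G\<^esub> y) \<in> U}"
          using nb xy by meson
      qed
    qed auto
  qed
qed

end

theory Submission
  imports Defs
begin

text \<open>
  Preorder \<open>G\<close> by \<open>x \<le> y\<close> iff \<open>y \<in> x S\<close>: open sets are the up-sets, closed sets the down-sets, and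
  \<open>x S\<close> is the least neighbourhood of \<open>x\<close>.  A nonempty closed compact set therefore lies above finitely
  many of its points, and a minimal one among these is minimal in \<open>G\<close>.  The preorder is invariant
  under translations, so every point is minimal, which says that \<open>S\<close> is a subgroup.  Each of the
  compactness conditions provides such a closed set.  Once \<open>S\<close> is a subgroup, compact sets meet only
  finitely many of its cosets; and if its index is finite, then the topology is finite and every subset
  is compact.
\<close>

lemma compactin_if_finite_topology:
  assumes "finite {U. openin X U}" and "C \<subseteq> topspace X"
  shows "compactin X C"
proof -
  have "finite \<U>" if "Ball \<U> (openin X)" for \<U>
    using that by (intro finite_subset[OF _ assms(1)]) auto
  then show ?thesis using assms(2) unfolding compactin_def by blast
qed

text \<open>Write x \<le> y for y \<in> x S. For a minimal \<open>f\<close> in \<open>F\<close> and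
  \<open>s\<close> in \<open>S\<close>, the point \<open>f \<otimes> inv s\<close> is below
  \<open>f\<close>, so it stays in \<open>K\<close> and lies above some \<open>g\<close> in
  \<open>F\<close>. Then g \<le> f, minimality gives f \<le> g, hence f \<le>
  \<open>f \<otimes> inv s\<close>, and cancelling \<open>f\<close> puts \<open>inv s\<close> in
  \<open>S\<close>. Topology is kept out so that the lemma serves both closed compact sets and the
  whole group.\<close>

lemma (in group) submonoid_is_subgroup_if_finitely_generated_down_set:
  assumes "submonoid S G" and "K \<subseteq> carrier G" and "K \<noteq> {}"
    and down: "\<And>v s. \<lbrakk>v \<in> carrier G; s \<in> S; v \<otimes> s \<in> K\<rbrakk> \<Longrightarrow> v \<in> K"
    and F: "finite F" "F \<subseteq> K" "K \<subseteq> F <#> S"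
  shows "subgroup S G"
proof -
  interpret S: submonoid S G by fact
  have [simp]: "s \<in> carrier G" if "s \<in> S" for s using that S.subset by blast
  have FG [simp]: "f \<in> carrier G" if "f \<in> F" for f using that F(2) assms(2) by blast
  \<comment> \<open>The preorder need not be antisymmetric, so minimality can only mean that g \<le>
    f implies f \<le> g. An element with the fewest members of \<open>F\<close> below it has this
    property.\<close>
  define below where "below f = {g \<in> F. \<exists>s\<in>S. f = g \<otimes> s}" for f
  have "F \<noteq> {}" using F(3) assms(3) by (auto simp: set_mult_def)
  then obtain f where f: "f \<in> F" and least: "\<And>g. g \<in> F \<Longrightarrow> card (below f) \<le> card (below g)"
    using ex_min_if_finite[of "(\<lambda>g. card (below g)) ` F"] F(1) by (force simp: not_less)
  have minimal: "\<exists>w\<in>S. g = f \<otimes> w" if g: "g \<in> F" "t \<in> S" "f = g \<otimes> t" for g t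
  proof -
    have "below g \<subseteq> below f"
    proof
      fix h assume "h \<in> below g"
      then obtain s where s: "h \<in> F" "s \<in> S" "g = h \<otimes> s" unfolding below_def by blast
      then have "f = h \<otimes> (s \<otimes> t)" using g by (simp add: m_assoc)
      then show "h \<in> below f" using s g(2) unfolding below_def by blast
    qed
    moreover have "finite (below f)" using F(1) by (simp add: below_def)
    ultimately have "below g = below f" using least[OF g(1)] by (simp add: card_seteq)
    \<comment> \<open>Reflexivity, through \<open>s = \<one>\<close>: now \<open>f\<close> belongs
      to \<open>below g\<close> as well, which is the wanted f \<le> g.\<close>
    moreover have "f \<in> below f" using f S.one_closed unfolding below_def by force
    ultimately show ?thesis unfolding below_def by blast
  qed
  have "inv s \<in> S" if s: "s \<in> S" for s
  proof -
    have "f \<otimes> inv s \<otimes> s = f" using s f by (simp add: m_assoc)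
    then have "f \<otimes> inv s \<in> K" using down[of "f \<otimes> inv s" s] s f F(2) by auto
    then obtain g t where gt: "g \<in> F" "t \<in> S" "f \<otimes> inv s = g \<otimes> t"
      using F(3) unfolding set_mult_def by blast
    then have "g \<otimes> t \<otimes> s = f" using \<open>f \<otimes> inv s \<otimes> s = f\<close> by argo
    then have "f = g \<otimes> (t \<otimes> s)" using gt s m_assoc[of g t s] by simp
    then obtain w where w: "w \<in> S" "g = f \<otimes> w"
      using minimal[of g "t \<otimes> s"] gt s by auto
    then have "f \<otimes> inv s = f \<otimes> (w \<otimes> t)" using gt f m_assoc[of f w t] by simp
    then have "inv s = w \<otimes> t" using f w gt s by simp
    then show ?thesis using w gt by simp
  qed
  moreover have "S \<noteq> {}" using S.one_closed by blast
  ultimately show ?thesis using S.subset by (intro subgroupI) auto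
qed

lemma (in group) closedin_translate_topology_down:
  assumes "submonoid S G" and K: "closedin (translate_topology G S) K"
    and v: "v \<in> carrier G" "s \<in> S" "v \<otimes> s \<in> K"
  shows "v \<in> K"
proof -
  have "openin (translate_topology G S) (carrier G - K)"
    using K topspace_translate_topology[OF is_group assms(1)] by (metis closedin_def)
  then have "\<forall>u\<in>carrier G - K. \<forall>s\<in>S. u \<otimes> s \<in> carrier G - K"
    by (simp add: openin_translate_topology[OF is_group assms(1)] translate_iff[OF is_group assms(1)])
  then show ?thesis using v by blast
qed

text \<open>Cover \<open>K\<close> by the least neighbourhoods of its own points. Centres inside
  \<open>K\<close> give \<open>F \<subseteq> K\<close>, which the minimality argument relies
  on.\<close>

lemma (in group) compactin_translate_topology_finite_cover:
  assumes "submonoid S G" and K: "compactin (translate_topology G S) K"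
  obtains F where "finite F" "F \<subseteq> K" "K \<subseteq> F <#> S"
proof -
  interpret S: submonoid S G by fact
  have KG: "K \<subseteq> carrier G"
    using compactin_subset_topspace[OF K] topspace_translate_topology[OF is_group assms(1)] by simp
  have "openin (translate_topology G S) ({x} <#> S)" if "x \<in> K" for x
    using that KG unfolding openin_translate_topology[OF is_group assms(1)] by blast
  moreover have "x \<in> {x} <#> S" if "x \<in> K" for x
    using that KG S.one_closed r_one[of x] unfolding set_mult_def by force
  ultimately obtain \<F> where "finite \<F>" "\<F> \<subseteq> (\<lambda>x. {x} <#> S) ` K" "K \<subseteq> \<Union>\<F>"
    using compactinD[OF K, of "(\<lambda>x. {x} <#> S) ` K"] by blast
  then obtain F where "finite F" "F \<subseteq> K" "\<F> = (\<lambda>x. {x} <#> S) ` F"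
    by (meson finite_subset_image)
  with \<open>K \<subseteq> \<Union>\<F>\<close> show thesis by (intro that[of F]) (auto simp: set_mult_def)
qed

lemma (in group) subgroup_if_closed_compact:
  assumes "submonoid S G" "closedin (translate_topology G S) K" "K \<noteq> {}"
    and K: "compactin (translate_topology G S) K"
  shows "subgroup S G"
proof -
  obtain F where "finite F" "F \<subseteq> K" "K \<subseteq> F <#> S"
    using compactin_translate_topology_finite_cover[OF assms(1) K] .
  moreover have "K \<subseteq> carrier G"
    using compactin_subset_topspace[OF K] topspace_translate_topology[OF is_group assms(1)] by simp
  ultimately show ?thesis
    using closedin_translate_topology_down[OF assms(1,2)] assms(1,3)
    by (intro submonoid_is_subgroup_if_finitely_generated_down_set[of S K F])
qed

text \<open>A point of \<open>F <#> S\<close> lies in the coset of some element of \<open>F\<close>.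
  The set \<open>A\<close> is arbitrary because the lemma is applied both to the whole group and to
  the range of a sequence.\<close>

lemma (in comm_group) finite_cosets_if_finite_cover:
  assumes "subgroup S G" "finite F" "F \<subseteq> carrier G" "A \<subseteq> F <#> S"
  shows "finite ((\<lambda>a. S #> a) ` A)"
proof (rule finite_subset)
  show "(\<lambda>a. S #> a) ` A \<subseteq> (\<lambda>f. S #> f) ` F"
  proof
    fix C assume "C \<in> (\<lambda>a. S #> a) ` A"
    then obtain f s where fs: "f \<in> F" "s \<in> S" "C = S #> (f \<otimes> s)"
      using assms(4) unfolding set_mult_def by blast
    moreover have sG: "s \<in> carrier G" using fs(2) subgroup.subset[OF assms(1)] by blast
    \<comment> \<open>\<open>F <#> S\<close> is a union of left cosets while \<open>rcosets\<close>
      collects right ones; commutativity identifies them.\<close>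
    ultimately have "f \<otimes> s = s \<otimes> f" using assms(3) by (intro m_comm) auto
    then have "f \<otimes> s \<in> S #> f" using fs(2) unfolding r_coset_def by blast
    then have "C = S #> f" using fs assms(1,3) repr_independence[of "f \<otimes> s" S f] by auto
    then show "C \<in> (\<lambda>f. S #> f) ` F" using fs(1) by blast
  qed
qed (use assms in simp)

lemma (in comm_group) finite_index_if_finite_cover:
  assumes "subgroup S G" "finite F" "F \<subseteq> carrier G" "carrier G \<subseteq> F <#> S"
  shows "finite (rcosets S)"
proof -
  have "rcosets S = (\<lambda>a. S #> a) ` carrier G" by (auto simp: RCOSETS_def)
  then show ?thesis using finite_cosets_if_finite_cover[OF assms] by simp
qed

text \<open>Every open set is a union of cosets of \<open>S\<close>, and finitely many cosets have
  only finitely many unions.\<close>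

lemma (in comm_group) finite_topology_if_finite_index:
  assumes S: "subgroup S G" and fin: "finite (rcosets S)"
  shows "finite {U. openin (translate_topology G S) U}"
proof (rule finite_subset)
  have "U \<in> Union ` Pow (rcosets S)" if "openin (translate_topology G S) U" for U
  proof -
    have U: "U \<subseteq> carrier G" "\<forall>u\<in>U. \<forall>s\<in>S. u \<otimes> s \<in> U"
      using that subgroup_is_submonoid[OF S]
      by (auto simp: openin_translate_topology[OF is_group] translate_iff[OF is_group])
    have "S #> u \<subseteq> U" if "u \<in> U" for u
      using that U subgroup.subset[OF S] by (auto simp: r_coset_def m_comm subset_iff)
    moreover have "u \<in> S #> u" if "u \<in> U" for u using that U S rcos_self by blast
    ultimately have "U = \<Union>((\<lambda>u. S #> u) ` U)" by blast
    moreover have "(\<lambda>u. S #> u) ` U \<in> Pow (rcosets S)" using U(1) by (auto simp: RCOSETS_def)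
    ultimately show ?thesis by blast
  qed
  then show "{U. openin (translate_topology G S) U} \<subseteq> Union ` Pow (rcosets S)" by blast
qed (use fin in simp)

text \<open>\<open>S\<close> is the least neighbourhood of \<open>\<one>\<close>, so one finite
  \<open>F\<close> with \<open>F <#> S\<close> equal to the group works for every
  neighbourhood.\<close>

lemma (in group) compact_imp_precompact:
  assumes "submonoid S G" "compact_space (translate_topology G S)"
  shows "precompact_group G (translate_topology G S)"
proof -
  have "compactin (translate_topology G S) (carrier G)"
    using assms(2) topspace_translate_topology[OF is_group assms(1)] by (simp add: compact_space_def)
  then obtain F where F: "finite F" "F \<subseteq> carrier G" "carrier G \<subseteq> F <#> S"
    using compactin_translate_topology_finite_cover[OF assms(1)] by blast
  have "F <#> U = carrier G"
    if U: "U \<subseteq> carrier G" and V: "openin (translate_topology G S) V" "\<one> \<in> V" "V \<subseteq> U" for U V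
  proof
    show "F <#> U \<subseteq> carrier G" using F(2) U by (rule set_mult_closed)
    have "\<one> \<otimes> s \<in> V" if "s \<in> S" for s
      using V that by (auto simp: openin_translate_topology[OF is_group assms(1)] translate_iff[OF is_group assms(1)])
    moreover have "\<one> \<otimes> s = s" if "s \<in> S" for s using that submonoid.subset[OF assms(1)] by auto
    ultimately have "S \<subseteq> U" using V(3) by fastforce
    then have "F <#> S \<subseteq> F <#> U" by (intro mono_set_mult) auto
    with F(3) show "carrier G \<subseteq> F <#> U" by blast
  qed
  with F(1,2) show ?thesis unfolding precompact_group_def by blast
qed

text \<open>Precompactness is applied to the neighbourhood \<open>S\<close> itself; the resulting
  \<open>F\<close> generates the whole group, which is trivially a down-set.\<close>

lemma (in comm_group) precompact_imp_subgroup_finite_index: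
  assumes "submonoid S G" "precompact_group G (translate_topology G S)"
  shows "subgroup S G \<and> finite (rcosets S)"
proof -
  interpret S: submonoid S G by fact
  have "openin (translate_topology G S) S"
    by (auto simp: openin_translate_topology[OF is_group assms(1)] translate_iff[OF is_group assms(1)])
  then have "\<exists>V. openin (translate_topology G S) V \<and> \<one> \<in> V \<and> V \<subseteq> S"
    using S.one_closed by (intro exI[of _ S]) simp
  then obtain F where F: "F \<subseteq> carrier G" "finite F" "F <#> S = carrier G"
    using assms(2) S.subset unfolding precompact_group_def by meson
  have "subgroup S G"
    using F assms(1) by (intro submonoid_is_subgroup_if_finitely_generated_down_set[of S "carrier G" F]) auto
  then show ?thesis using finite_index_if_finite_cover[of S F] F by simp
qed

lemma omega_bounded_imp_totally_countably_compact:
  assumes "omega_bounded X"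
  shows "totally_countably_compact X"
  unfolding totally_countably_compact_def
proof (intro allI impI)
  fix x :: "nat \<Rightarrow> 'a" assume "range x \<subseteq> topspace X"
  then have "compactin X (X closure_of range (x \<circ> id))"
    using assms by (simp add: omega_bounded_def)
  then show "\<exists>r::nat \<Rightarrow> nat. strict_mono r \<and> compactin X (X closure_of range (x \<circ> r))"
    using strict_mono_id by blast
qed

lemma (in comm_group) totally_countably_compact_imp_subgroup_finite_index:
  assumes sub: "submonoid S G" and tcc: "totally_countably_compact (translate_topology G S)"
  shows "subgroup S G \<and> finite (rcosets S)"
proof -
  let ?X = "translate_topology G S"
  have top: "topspace ?X = carrier G" using topspace_translate_topology[OF is_group sub] .
  \<comment> \<open>All subsequences of the constant sequence have the same range, so the closure of
    \<open>{\<one>}\<close> is a nonempty closed compact set.\<close>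
  have "range (\<lambda>n::nat. \<one>) \<subseteq> topspace ?X" by (simp add: top)
  then obtain r :: "nat \<Rightarrow> nat" where "compactin ?X (?X closure_of range ((\<lambda>n. \<one>) \<circ> r))"
    using tcc unfolding totally_countably_compact_def by meson
  moreover have "range ((\<lambda>n. \<one>) \<circ> r) = {\<one>}" by auto
  moreover have "\<one> \<in> ?X closure_of {\<one>}"
    using closure_of_subset[of "{\<one>}" ?X] top by simp
  ultimately have S: "subgroup S G"
    using subgroup_if_closed_compact[OF sub closedin_closure_of] by fastforce
  have "finite (rcosets S)"
  proof (rule ccontr)
    assume "infinite (rcosets S)"
    \<comment> \<open>Representatives of distinct cosets form a sequence each of whose subsequences
      meets infinitely many cosets, whereas a compact closure meets only finitely many.\<close>
    then obtain c :: "nat \<Rightarrow> 'a set" where c: "inj c" "range c \<subseteq> rcosets S"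
      using infinite_countable_subset by blast
    then have "\<forall>n. \<exists>a\<in>carrier G. c n = S #> a" by (auto simp: RCOSETS_def)
    then obtain x where x: "\<And>n. x n \<in> carrier G" "\<And>n. c n = S #> x n" by metis
    then have xG: "range x \<subseteq> topspace ?X" using top by auto
    then obtain r :: "nat \<Rightarrow> nat"
      where r: "strict_mono r" "compactin ?X (?X closure_of range (x \<circ> r))"
      using tcc unfolding totally_countably_compact_def by meson
    obtain F where F: "finite F" "F \<subseteq> ?X closure_of range (x \<circ> r)"
      "?X closure_of range (x \<circ> r) \<subseteq> F <#> S"
      using compactin_translate_topology_finite_cover[OF sub r(2)] .
    have "F \<subseteq> carrier G" using F(2) closure_of_subset_topspace[of ?X] top by blast
    moreover have "range (x \<circ> r) \<subseteq> F <#> S"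
      using F(3) closure_of_subset[of "range (x \<circ> r)" ?X] xG by fastforce
    ultimately have "finite ((\<lambda>a. S #> a) ` range (x \<circ> r))"
      using finite_cosets_if_finite_cover[OF S F(1)] by blast
    moreover have "(\<lambda>a. S #> a) ` range (x \<circ> r) = range (c \<circ> r)" using x(2) by auto
    moreover have "inj (c \<circ> r)" using c(1) r(1) by (simp add: inj_compose strict_mono_imp_inj_on)
    ultimately show False using range_inj_infinite by metis
  qed
  with S show ?thesis ..
qed

theorem proposition5p8:
  fixes G :: "('a, 'b) monoid_scheme" and S :: "'a set"
  assumes "comm_group G" and "submonoid S G"
  defines "G\<^sub>S \<equiv> translate_topology G S"
  shows "(compact_space G\<^sub>S \<longleftrightarrow> omega_bounded G\<^sub>S)
    \<and> (omega_bounded G\<^sub>S \<longleftrightarrow> totally_countably_compact G\<^sub>S)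
    \<and> (totally_countably_compact G\<^sub>S \<longleftrightarrow> precompact_group G G\<^sub>S)
    \<and> (precompact_group G G\<^sub>S \<longleftrightarrow> subgroup S G \<and> finite (rcosets\<^bsub>G\<^esub> S))"
proof -
  interpret comm_group G by fact
  let ?finite_index = "subgroup S G \<and> finite (rcosets\<^bsub>G\<^esub> S)"
  \<comment> \<open>The implications form two cycles through \<open>?finite_index\<close>: one by
    compactness and precompactness, the other by \<open>omega_bounded\<close> and
    \<open>totally_countably_compact\<close>. Compactness of all subsets starts both.\<close>
  have "compactin G\<^sub>S C" if "?finite_index" "C \<subseteq> topspace G\<^sub>S" for C
    using that finite_topology_if_finite_index compactin_if_finite_topology unfolding G\<^sub>S_def by blast
  then have "compact_space G\<^sub>S" "omega_bounded G\<^sub>S" if "?finite_index"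
    using that closure_of_subset_topspace[of G\<^sub>S] by (auto simp: compact_space_def omega_bounded_def)
  moreover have "compact_space G\<^sub>S \<Longrightarrow> precompact_group G G\<^sub>S"
    using compact_imp_precompact[OF assms(2)] by (simp add: G\<^sub>S_def)
  moreover have "precompact_group G G\<^sub>S \<Longrightarrow> ?finite_index"
    using precompact_imp_subgroup_finite_index[OF assms(2)] by (simp add: G\<^sub>S_def)
  moreover have "totally_countably_compact G\<^sub>S \<Longrightarrow> ?finite_index"
    using totally_countably_compact_imp_subgroup_finite_index[OF assms(2)] by (simp add: G\<^sub>S_def)
  moreover have "omega_bounded G\<^sub>S \<Longrightarrow> totally_countably_compact G\<^sub>S"
    by (rule omega_bounded_imp_totally_countably_compact)
  ultimately show ?thesis by blast
qed

end
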